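(* Let $(a_i)_{i \geq 1}$ be a non-decreasing sequence of integers, and let $L_n$ be the number of times $n$ appears in the sequence. Suppose that for some $\varepsilon > 0$ and for all large enough $n$, \[ \sum_{\substack{m < n\\ \gcd(m,n) = 1}} L_m \geq 2 n^2 \] and \[ \sum_{m=1}^{n-1} m^2 L_m \geq n^2 \log^{3+\varepsilon}(n) \max(4L_n, n^2). \] Then the Rademacher random walk $X$ associated with $(a_i)_{i \geq 1}$ is transient.
   Context: Let $\epsilon_1, \epsilon_2, \dots$ be independent Rademacher random variables, taking the values $\pm 1$ each with probability $1/2$. The Rademacher random walk associated with a deterministic sequence $(a_n)_{n\ge1}$ of non-negative real numbers is $X = (X_n)_{n\ge 0}$, where $X_n = \sum_{k=1}^n \epsilon_k a_k$. The walk is called weakly recurrent if the (tail) event that there exists $C$ such that $|X_n| \le C$ for infinitely many $n$ has probability $1$; otherwise the walk is called transient. Here $\log^{3+\varepsilon}(n)$ means $(\log n)^{3+\varepsilon}$. *)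

theory Defs
  imports "HOL-Probability.Probability"
begin

text \<open>
  Signs and step sizes are indexed from 1 (their values at index 0 are never used); the walk starts at 0.
\<close>

definition rademacher_sequence :: "'a measure \<Rightarrow> (nat \<Rightarrow> 'a \<Rightarrow> real) \<Rightarrow> bool" where
  "rademacher_sequence M \<epsilon> \<longleftrightarrow>
     prob_space M \<and>
     prob_space.indep_vars M (\<lambda>_. borel) \<epsilon> {1..} \<and>
     (\<forall>k\<ge>1. measure M {\<omega> \<in> space M. \<epsilon> k \<omega> = 1} = 1 / 2 \<and>
            measure M {\<omega> \<in> space M. \<epsilon> k \<omega> = -1} = 1 / 2)"

definition rademacher_walk ::
    "(nat \<Rightarrow> 'a \<Rightarrow> real) \<Rightarrow> (nat \<Rightarrow> real) \<Rightarrow> nat \<Rightarrow> 'a \<Rightarrow> real" where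
  "rademacher_walk \<epsilon> a n \<omega> = (\<Sum>k=1..n. \<epsilon> k \<omega> * a k)"

definition weakly_recurrent :: "'a measure \<Rightarrow> (nat \<Rightarrow> 'a \<Rightarrow> real) \<Rightarrow> bool" where
  "weakly_recurrent M X \<longleftrightarrow>
     measure M {\<omega> \<in> space M. \<exists>C::real. \<exists>\<^sub>\<infinity>n. \<bar>X n \<omega>\<bar> \<le> C} = 1"

definition transient :: "'a measure \<Rightarrow> (nat \<Rightarrow> 'a \<Rightarrow> real) \<Rightarrow> bool" where
  "transient M X \<longleftrightarrow> \<not> weakly_recurrent M X"

text \<open>
  The number of indices at which the value \<open>n\<close> occurs. Multiplicities are meant to be finite;
  \<^const>\<open>card\<close> returns 0 when a value occurs infinitely often. A non-decreasing sequence with such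
  a value is eventually constant, so all but finitely many multiplicities are then 0 and sums
  of multiplicities (or of any fixed weights times multiplicities) stay bounded.
\<close>
definition multiplicity_of :: "(nat \<Rightarrow> nat) \<Rightarrow> nat \<Rightarrow> nat" where
  "multiplicity_of a n = card {i. i \<ge> 1 \<and> a i = n}"

end

theory Submission
  imports Defs "HOL-Number_Theory.Cong"
begin

text \<open>
  Split time into blocks, the block of \<open>n\<close> being the times at which the step size is \<open>n\<close>. During this
  block the walk does not change its residue mod \<open>n\<close>, so it can visit an integer \<open>c\<close> only if it is
  congruent to \<open>c\<close> mod \<open>n\<close> at the end of the block. Moreover, once it has visited \<open>c\<close>, the rest of the
  block moves it by at most \<open>n * sqrt (2 * L n)\<close> with probability at least one half. Hence the
  probability of a visit is at most twice the probability that, at the end of the block, the walk is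
  congruent to \<open>c\<close> mod \<open>n\<close> and within \<open>R\<close> of \<open>c\<close>, where \<open>R = 2 * n * sqrt (max (4 * L n) (n\<^sup>2))\<close>
  (lemma \<open>visit_le_twice_final_near\<close>).

  Heuristically this event has probability of order \<open>(1 / n) * (R / \<sigma>)\<close>, where \<open>\<sigma>\<^sup>2\<close> is the
  variance of the steps smaller than \<open>n\<close>: the residue should be nearly uniform up to parity, and the walk spreads over
  a range of length \<open>\<sigma>\<close>. Lemma \<open>anticoncentration_mod\<close> proves the upper bound by Fourier analysis.
  The congruence is detected by the frequencies \<open>2 * pi * j / n\<close> and the window by a nonnegative
  kernel whose frequencies are at most \<open>1 / R\<close>. Since \<open>R\<close> is at least \<open>2 * n\<^sup>2\<close>, a step \<open>m < n\<close> sees the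
  window frequencies as a perturbation of size below \<open>1 / (2 * n)\<close>, whereas the angle \<open>2 * pi * m * j / n\<close>
  is either a multiple of \<open>pi\<close> or at distance at least \<open>pi / n\<close> from all of them. So the characteristic
  function near \<open>2 * pi * j / n\<close> is bounded by a product (\<open>abs_cos_near_fraction_le\<close>): one factor depends
  only on \<open>j\<close>, and the other is Gaussian in the perturbation. Integrating the Gaussian gives \<open>R / \<sigma>\<close>.
  The sum of the first factor over \<open>j\<close> is bounded because at least \<open>2 * n\<^sup>2\<close> steps are coprime to \<open>n\<close>:
  by convexity it suffices that all these steps are equal, and multiplication by a unit permutes the
  residues, so they may be taken equal to one (\<open>sum_exp_coprime_steps_le\<close>).

  The variance hypothesis turns \<open>R / (n * \<sigma>)\<close> into a multiple of \<open>1 / (n * ln n powr (3/2))\<close>, which is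
  summable. By the Borel-Cantelli lemma almost surely \<open>c\<close> is visited in finitely many blocks only, that
  is, finitely often; and a walk on the integers that returned infinitely often to a bounded set would
  visit one of its points infinitely often.
\<close>

section \<open>Averages over sign patterns\<close>

text \<open>
  Signs are lists of booleans, so that one can induct on the first step of the walk. All probabilities
  below are averages over the finite set of sign patterns; this makes the exchange of expectation and
  integral a matter of finite sums.
\<close>

definition sign_avg :: "nat \<Rightarrow> (bool list \<Rightarrow> real) \<Rightarrow> real" where
  "sign_avg N F = (\<Sum>s | length s = N. F s) / 2 ^ N"

fun signed_sum :: "(nat \<Rightarrow> nat) \<Rightarrow> nat \<Rightarrow> bool list \<Rightarrow> int" where
  "signed_sum a q [] = 0"
| "signed_sum a q (b # s) = (if b then int (a q) else - int (a q)) + signed_sum a (Suc q) s"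

lemma sign_avg_0 [simp]: "sign_avg 0 F = F []"
  by (simp add: sign_avg_def)

lemma sign_avg_Suc: "sign_avg (Suc N) F = (sign_avg N (\<lambda>s. F (True # s)) + sign_avg N (\<lambda>s. F (False # s))) / 2"
proof -
  have split: "{s :: bool list. length s = Suc N}
      = Cons True ` {s. length s = N} \<union> Cons False ` {s. length s = N}"
    by (auto simp: length_Suc_conv image_iff) 
  have "(\<Sum>s | length s = Suc N. F s) = (\<Sum>s | length s = N. F (True # s)) + (\<Sum>s | length s = N. F (False # s))"
    unfolding split
    by (subst sum.union_disjoint) (auto simp: finite_list_length sum.reindex)
  then show ?thesis
    by (simp add: sign_avg_def add_divide_distrib)
qed

lemma sign_avg_mono: "(\<And>s. length s = N \<Longrightarrow> F s \<le> G s) \<Longrightarrow> sign_avg N F \<le> sign_avg N G"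
  unfolding sign_avg_def by (intro divide_right_mono sum_mono) auto

lemma sign_avg_const [simp]: "sign_avg N (\<lambda>_. x) = x"
  by (induction N) (auto simp: sign_avg_Suc)

lemma sign_avg_add: "sign_avg N (\<lambda>s. F s + G s) = sign_avg N F + sign_avg N G"
  by (simp add: sign_avg_def sum.distrib add_divide_distrib)

lemma sign_avg_cmult: "sign_avg N (\<lambda>s. x * F s) = x * sign_avg N F"
  by (simp add: sign_avg_def sum_distrib_left)

lemma sign_avg_sum: "sign_avg N (\<lambda>s. \<Sum>j\<in>J. F j s) = (\<Sum>j\<in>J. sign_avg N (F j))"
  unfolding sign_avg_def by (subst sum.swap) (simp add: sum_divide_distrib)

lemma sign_avg_integral:
  assumes "\<And>s. (\<lambda>u. F u s) integrable_on A"
  shows "sign_avg N (\<lambda>s. integral A (\<lambda>u. F u s)) = integral A (\<lambda>u. sign_avg N (F u))"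
    and "(\<lambda>u. sign_avg N (F u)) integrable_on A"
  unfolding sign_avg_def using assms
  by (simp_all add: integral_sum finite_list_length integrable_sum)

lemma sign_avg_cos_signed_sum:
  "sign_avg N (\<lambda>s. cos (\<theta> * (x + of_int (signed_sum a q s))))
     = cos (\<theta> * x) * (\<Prod>i\<in>{q..<q+N}. cos (\<theta> * real (a i)))"
proof (induction N arbitrary: q x)
  case (Suc N)
  have eq: "x + of_int (signed_sum a q (True # s)) = (x + real (a q)) + of_int (signed_sum a (Suc q) s)"
     "x + of_int (signed_sum a q (False # s)) = (x - real (a q)) + of_int (signed_sum a (Suc q) s)" for s
    by simp_all
  have ivl: "{q..<q + Suc N} = insert q {Suc q..<Suc q + N}" by auto
  show ?case
    unfolding sign_avg_Suc eq Suc.IH ivl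
    by (simp add: cos_add cos_diff algebra_simps)
qed simp

lemma sign_avg_signed_sum_squared:
  "sign_avg N (\<lambda>s. (x + of_int (signed_sum a q s))\<^sup>2) = x\<^sup>2 + (\<Sum>i\<in>{q..<q+N}. (real (a i))\<^sup>2)"
proof (induction N arbitrary: q x)
  case (Suc N)
  have eq: "x + of_int (signed_sum a q (True # s)) = (x + real (a q)) + of_int (signed_sum a (Suc q) s)"
     "x + of_int (signed_sum a q (False # s)) = (x - real (a q)) + of_int (signed_sum a (Suc q) s)" for s
    by simp_all
  have ivl: "{q..<q + Suc N} = insert q {Suc q..<Suc q + N}" by auto
  show ?case
    unfolding sign_avg_Suc eq Suc.IH ivl
    by (simp add: power2_eq_square algebra_simps)
qed simp

section \<open>Visits to a point during a block of equal steps\<close>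

lemma dvd_signed_sum:
  "(\<And>i. q \<le> i \<Longrightarrow> i < q + length s \<Longrightarrow> a i = n) \<Longrightarrow> int n dvd signed_sum a q s"
proof (induction s arbitrary: q)
  case (Cons b s)
  have "int n dvd signed_sum a (Suc q) s" using Cons.prems by (intro Cons.IH) auto
  moreover have "a q = n" using Cons.prems by auto
  ultimately show ?case by auto
qed simp

text \<open>
  By Chebyshev's inequality: the displacement after \<open>N\<close> steps \<open>\<plusminus>n\<close> has variance \<open>N * n\<^sup>2\<close>, at most half of
  \<open>r\<^sup>2\<close>.
\<close>

lemma signed_sum_near_zero_ge_half:
  assumes steps: "\<And>i. q \<le> i \<Longrightarrow> i < q + N \<Longrightarrow> a i = n"
    and r: "r > 0" "2 * (real n)\<^sup>2 * real N \<le> r\<^sup>2"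
  shows "1 \<le> 2 * sign_avg N (\<lambda>s. of_bool (int n dvd signed_sum a q s \<and> \<bar>of_int (signed_sum a q s)\<bar> \<le> r))"
proof -
  define W where "W s = (of_int (signed_sum a q s) :: real)" for s
  have "sign_avg N (\<lambda>s. (W s)\<^sup>2) = real N * (real n)\<^sup>2"
    using sign_avg_signed_sum_squared[of N 0 a q] steps by (simp add: W_def)
  then have sq: "(1 / r\<^sup>2) * sign_avg N (\<lambda>s. (W s)\<^sup>2) \<le> 1/2"
    using r by (simp add: field_simps)
  have "1 = sign_avg N (\<lambda>s. 1)" by simp
  also have "\<dots> \<le> sign_avg N (\<lambda>s. of_bool (int n dvd signed_sum a q s \<and> \<bar>W s\<bar> \<le> r) + (1 / r\<^sup>2) * (W s)\<^sup>2)"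
  proof (rule sign_avg_mono)
    fix s :: "bool list" assume len: "length s = N"
    have dvd: "int n dvd signed_sum a q s" using steps len by (intro dvd_signed_sum) auto
    show "1 \<le> of_bool (int n dvd signed_sum a q s \<and> \<bar>W s\<bar> \<le> r) + (1 / r\<^sup>2) * (W s)\<^sup>2"
    proof (cases "\<bar>W s\<bar> \<le> r")
      case False
      then have "r\<^sup>2 \<le> (W s)\<^sup>2" using r abs_le_square_iff[of r "W s"] by auto
      then show ?thesis using r False by (simp add: field_simps)
    qed (simp add: dvd)
  qed
  also have "\<dots> = sign_avg N (\<lambda>s. of_bool (int n dvd signed_sum a q s \<and> \<bar>W s\<bar> \<le> r)) + (1 / r\<^sup>2) * sign_avg N (\<lambda>s. (W s)\<^sup>2)"
    unfolding sign_avg_add sign_avg_cmult ..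
  finally show ?thesis using sq unfolding W_def by linarith
qed

text \<open>
  Here \<open>q\<close> is the index of the next step and all steps with index above \<open>p\<close> equal \<open>n\<close>; a visit
  counts if it happens at or after the beginning of the block, i.e. if at least \<open>p\<close> steps are done.
  The induction on the number of remaining steps is a first-passage decomposition: until the first visit
  both sides average over the next step, and at the first visit the left side is \<open>1\<close> and Chebyshev's
  inequality bounds the right side from below by \<open>1\<close>.
\<close>

lemma visit_le_twice_final_near:
  assumes "\<And>i. p < i \<Longrightarrow> i < q + N \<Longrightarrow> a i = n"
    and "r > 0" "2 * (real n)\<^sup>2 * (real (q + N) - 1 - real p) \<le> r\<^sup>2"
  shows "sign_avg N (\<lambda>s. of_bool (\<exists>k\<le>N. q + k > p \<and> x + signed_sum a q (take k s) = c))
     \<le> 2 * sign_avg N (\<lambda>s. of_bool (int n dvd x + signed_sum a q s - c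
                          \<and> \<bar>of_int (x + signed_sum a q s - c)\<bar> \<le> r))"
  using assms
proof (induction N arbitrary: q x)
  case 0
  then show ?case by auto
next
  case (Suc N)
  let ?hit = "\<lambda>s. \<exists>k\<le>Suc N. q + k > p \<and> x + signed_sum a q (take k s) = c"
  let ?near = "\<lambda>q x s. int n dvd x + signed_sum a q s - c \<and> \<bar>of_int (x + signed_sum a q s - c)\<bar> \<le> r"
  show ?case
  proof (cases "q > p \<and> x = c")
    case True
    have "2 * (real n)\<^sup>2 * real (Suc N) \<le> 2 * (real n)\<^sup>2 * (real (q + Suc N) - 1 - real p)"
      using True by (intro mult_left_mono) auto
    then have "2 * (real n)\<^sup>2 * real (Suc N) \<le> r\<^sup>2" using Suc.prems(3) by linarith
    then have "1 \<le> 2 * sign_avg (Suc N) (\<lambda>s. of_bool (?near q x s))"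
      using signed_sum_near_zero_ge_half[of q "Suc N" a n r] Suc.prems True by simp
    moreover have "sign_avg (Suc N) (\<lambda>s. of_bool (?hit s)) \<le> sign_avg (Suc N) (\<lambda>s. 1)"
      by (rule sign_avg_mono) auto
    ultimately show ?thesis by simp
  next
    case False
    let ?hit' = "\<lambda>y s. \<exists>k\<le>N. Suc q + k > p \<and> y + signed_sum a (Suc q) (take k s) = c"
    let ?up = "x + int (a q)" and ?dn = "x - int (a q)"
    have shift: "(\<exists>k\<le>Suc N. P k) \<longleftrightarrow> P 0 \<or> (\<exists>k\<le>N. P (Suc k))" for P
      by (metis Suc_le_mono le0 not0_implies_Suc)
    have hit: "?hit (True # s) = ?hit' ?up s" "?hit (False # s) = ?hit' ?dn s" for s
      using False by (auto simp: shift add.assoc)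
    have near: "?near q x (True # s) = ?near (Suc q) ?up s" "?near q x (False # s) = ?near (Suc q) ?dn s" for s
      by (simp_all add: algebra_simps)
    have IH: "sign_avg N (\<lambda>s. of_bool (?hit' y s)) \<le> 2 * sign_avg N (\<lambda>s. of_bool (?near (Suc q) y s))" for y
      using Suc.prems by (intro Suc.IH) auto
    have halves: "(A + B) / 2 \<le> 2 * ((C + D) / 2)" if "A \<le> 2 * C" "B \<le> 2 * D" for A B C D :: real
      using that by simp
    show ?thesis
      unfolding sign_avg_Suc hit near by (rule halves[OF IH[of ?up] IH[of ?dn]])
  qed
qed

section \<open>Characteristic functions near the fractions of the circle\<close>

lemma cos_ge_one_minus_half_square: "cos x \<ge> 1 - x\<^sup>2 / 2" for x :: real
proof -
  have "(sin (x/2))\<^sup>2 \<le> (x/2)\<^sup>2"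
    using abs_sin_x_le_abs_x[of "x/2"] unfolding abs_le_square_iff .
  moreover have "cos x = 1 - 2 * (sin (x/2))\<^sup>2"
    using cos_double_sin[of "x/2"] by simp
  ultimately show ?thesis by (simp add: power_divide)
qed

lemma abs_sin_ge_half_abs:
  fixes x :: real
  assumes "\<bar>x\<bar> \<le> pi / 2"
  shows "\<bar>x\<bar> / 2 \<le> \<bar>sin x\<bar>"
proof -
  have "\<bar>sin x - x\<bar> \<le> \<bar>x\<bar> ^ 3 / 6"
    using Maclaurin_sin_bound[of x 3] by (simp add: eval_nat_numeral sin_coeff_def)
  moreover have "\<bar>x\<bar> ^ 3 / 6 \<le> \<bar>x\<bar> / 2"
  proof -
    have "\<bar>x\<bar> \<le> 1.6" using assms pi_less_4 pi_approx by simp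
    then have "\<bar>x\<bar> * \<bar>x\<bar> \<le> 1.6 * 1.6" by (intro mult_mono) auto
    then have "\<bar>x\<bar> * \<bar>x\<bar> * \<bar>x\<bar> \<le> 3 * \<bar>x\<bar>" by (intro mult_right_mono) auto
    then show ?thesis by (simp add: eval_nat_numeral)
  qed
  ultimately show ?thesis by linarith
qed

lemma abs_cos_le_exp: "\<bar>cos x\<bar> \<le> exp (- (sin x)\<^sup>2 / 2)" for x :: real
proof -
  have "(cos x)\<^sup>2 = 1 - (sin x)\<^sup>2" by (simp add: cos_squared_eq)
  also have "\<dots> \<le> exp (- (sin x)\<^sup>2)" using exp_ge_add_one_self[of "- (sin x)\<^sup>2"] by simp
  also have "\<dots> = (exp (- (sin x)\<^sup>2 / 2))\<^sup>2" by (simp add: exp_double[symmetric])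
  finally show ?thesis by (metis abs_le_square_iff abs_exp_cancel)
qed

text \<open>
  A perturbation \<open>\<beta>\<close> that is small compared with \<open>sin \<alpha>\<close> cannot cancel it. At a zero of the sine, the
  perturbation itself gives the contribution \<open>\<beta>\<^sup>2\<close>. In both cases the two contributions add up,
  up to a constant.
\<close>

lemma sin_add_squared_ge:
  fixes \<alpha> \<beta> :: real
  assumes "\<bar>\<beta>\<bar> \<le> 1 / 2" "sin \<alpha> = 0 \<or> 3 * \<bar>\<beta>\<bar> \<le> \<bar>sin \<alpha>\<bar>"
  shows "((sin \<alpha>)\<^sup>2 + \<beta>\<^sup>2) / 8 \<le> (sin (\<alpha> + \<beta>))\<^sup>2"
proof (cases "sin \<alpha> = 0")
  case True
  then have "(cos \<alpha>)\<^sup>2 = 1" by (simp add: cos_squared_eq)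
  then have "(sin (\<alpha> + \<beta>))\<^sup>2 = (sin \<beta>)\<^sup>2" by (simp add: sin_add True power_mult_distrib)
  moreover have "(\<bar>\<beta>\<bar> / 2)\<^sup>2 \<le> \<bar>sin \<beta>\<bar>\<^sup>2"
    using assms pi_gt3 by (intro power_mono abs_sin_ge_half_abs) auto
  ultimately show ?thesis using True by (simp add: power_divide) (use zero_le_power2[of \<beta>] in linarith)
next
  case False
  then have small: "3 * \<bar>\<beta>\<bar> \<le> \<bar>sin \<alpha>\<bar>" using assms by auto
  have "\<beta>\<^sup>2 \<le> (1/2)\<^sup>2" using assms by (metis abs_ge_zero power2_abs power_mono)
  then have cos: "cos \<beta> \<ge> 7/8" using cos_ge_one_minus_half_square[of \<beta>] by (simp add: power_divide)
  have "\<bar>sin \<alpha>\<bar> * (7/8) - 1 * \<bar>\<beta>\<bar> \<le> \<bar>sin \<alpha>\<bar> * \<bar>cos \<beta>\<bar> - \<bar>cos \<alpha>\<bar> * \<bar>sin \<beta>\<bar>"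
    using cos abs_sin_x_le_abs_x[of \<beta>] by (intro diff_mono mult_mono) auto
  also have "\<dots> \<le> \<bar>sin (\<alpha> + \<beta>)\<bar>"
    unfolding sin_add abs_mult[symmetric] by linarith
  finally have "\<bar>sin \<alpha>\<bar> / 2 \<le> \<bar>sin (\<alpha> + \<beta>)\<bar>" using small by linarith
  then have "(\<bar>sin \<alpha>\<bar> / 2)\<^sup>2 \<le> \<bar>sin (\<alpha> + \<beta>)\<bar>\<^sup>2" by (intro power_mono) auto
  moreover have "\<bar>\<beta>\<bar>\<^sup>2 \<le> \<bar>sin \<alpha>\<bar>\<^sup>2" using small by (intro power_mono) auto
  ultimately show ?thesis by (simp add: power_divide)
qed

lemma abs_sin_pi_frac_ge:
  fixes j n :: nat
  assumes "j \<le> n" "n > 0"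
  shows "3 * real (min j (n - j)) / (2 * real n) \<le> \<bar>sin (pi * real j / real n)\<bar>"
proof -
  define k where "k = min j (n - j)"
  have "\<bar>sin (pi * real j / real n)\<bar> = \<bar>sin (pi * real k / real n)\<bar>"
  proof (cases "j \<le> n - j")
    case False
    then have "pi * real k / real n = pi - pi * real j / real n"
      using assms by (simp add: k_def min_def of_nat_diff field_simps)
    then show ?thesis by simp
  qed (simp add: k_def min_def)
  moreover have "\<bar>pi * real k / real n\<bar> / 2 \<le> \<bar>sin (pi * real k / real n)\<bar>"
  proof (rule abs_sin_ge_half_abs)
    have "2 * k \<le> n" using assms by (auto simp: k_def min_def)
    then have "2 * real k \<le> real n" by linarith
    then have "pi * (2 * real k) \<le> pi * real n" by (intro mult_left_mono) auto
    then show "\<bar>pi * real k / real n\<bar> \<le> pi / 2" using assms by (simp add: field_simps)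
  qed
  moreover have "3 * real k / (2 * real n) \<le> \<bar>pi * real k / real n\<bar> / 2"
    using assms mult_right_mono[of 3 pi "real k"] pi_gt3 by (simp add: field_simps)
  ultimately show ?thesis unfolding k_def by linarith
qed

lemma sin_pi_frac_mod:
  fixes l n :: nat
  assumes "n > 0"
  shows "\<bar>sin (pi * real l / real n)\<bar> = \<bar>sin (pi * real (l mod n) / real n)\<bar>"
proof -
  have "real l = real n * real (l div n) + real (l mod n)"
    by (metis mult_div_mod_eq of_nat_add of_nat_mult)
  then have "pi * real l / real n = pi * real (l mod n) / real n + real (l div n) * pi"
    using assms by (simp add: field_simps)
  then show ?thesis
    by (simp add: sin_add abs_mult)
qed

lemma sin_pi_frac_zero_or_large:
  fixes l n :: nat
  assumes "n > 0"
  shows "sin (pi * real l / real n) = 0 \<or> 3 / (2 * real n) \<le> \<bar>sin (pi * real l / real n)\<bar>"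
proof (cases "l mod n = 0")
  case True
  then show ?thesis using sin_pi_frac_mod[OF assms, of l] by simp
next
  case False
  define k where "k = l mod n"
  have "k < n" "k > 0" using assms False by (auto simp: k_def)
  then have "1 \<le> real (min k (n - k))" by simp
  then have "3 / (2 * real n) \<le> 3 * real (min k (n - k)) / (2 * real n)"
    using assms by (simp add: field_simps)
  also have "\<dots> \<le> \<bar>sin (pi * real k / real n)\<bar>"
    using \<open>k < n\<close> assms by (intro abs_sin_pi_frac_ge) auto
  finally show ?thesis using sin_pi_frac_mod[OF assms, of l] by (simp add: k_def)
qed

text \<open>
  The bound on \<open>t\<close> keeps the perturbation \<open>t * m\<close> within a third of the smallest nonzero value of
  \<open>\<bar>sin (pi * l / n)\<bar>\<close>. The conclusion separates the dependence on \<open>j\<close> from the one on \<open>t\<close>.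
\<close>

lemma abs_cos_near_fraction_le:
  fixes j m n :: nat and t :: real
  assumes "m < n" "2 * (real n)\<^sup>2 * \<bar>t\<bar> \<le> 1"
  shows "\<bar>cos ((2 * pi * real j / real n + t) * real m)\<bar>
    \<le> exp (- ((sin (2 * pi * real (j * m) / real n))\<^sup>2 + (t * real m)\<^sup>2) / 16)"
proof -
  define \<alpha> where "\<alpha> = 2 * pi * real (j * m) / real n"
  define \<beta> where "\<beta> = t * real m"
  have n: "real n \<ge> 1" using assms by linarith
  have "\<bar>\<beta>\<bar> \<le> \<bar>t\<bar> * real n" unfolding \<beta>_def abs_mult using assms by (intro mult_left_mono) auto
  then have "2 * real n * \<bar>\<beta>\<bar> \<le> 2 * real n * (\<bar>t\<bar> * real n)" by (intro mult_left_mono) auto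
  also have "\<dots> \<le> 1" using assms by (simp add: power2_eq_square mult_ac)
  finally have \<beta>: "2 * real n * \<bar>\<beta>\<bar> \<le> 1" .
  have "2 * 1 * \<bar>\<beta>\<bar> \<le> 2 * real n * \<bar>\<beta>\<bar>" using n by (intro mult_right_mono) auto
  with \<beta> have half: "\<bar>\<beta>\<bar> \<le> 1/2" by linarith
  have "3 * \<bar>\<beta>\<bar> \<le> 3 / (2 * real n)" using \<beta> n by (simp add: field_simps)
  moreover have "sin \<alpha> = 0 \<or> 3 / (2 * real n) \<le> \<bar>sin \<alpha>\<bar>"
    using sin_pi_frac_zero_or_large[of n "2 * (j * m)"] n by (simp add: \<alpha>_def mult_ac)
  ultimately have "((sin \<alpha>)\<^sup>2 + \<beta>\<^sup>2) / 8 \<le> (sin (\<alpha> + \<beta>))\<^sup>2"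
    using half by (intro sin_add_squared_ge) auto
  then have "exp (- (sin (\<alpha> + \<beta>))\<^sup>2 / 2) \<le> exp (- ((sin \<alpha>)\<^sup>2 + \<beta>\<^sup>2) / 16)" by simp
  with abs_cos_le_exp[of "\<alpha> + \<beta>"]
  have "\<bar>cos (\<alpha> + \<beta>)\<bar> \<le> exp (- ((sin \<alpha>)\<^sup>2 + \<beta>\<^sup>2) / 16)" by (rule order_trans)
  moreover have "(2 * pi * real j / real n + t) * real m = \<alpha> + \<beta>"
    by (simp add: \<alpha>_def \<beta>_def algebra_simps)
  ultimately show ?thesis unfolding \<alpha>_def[symmetric] \<beta>_def[symmetric] by simp
qed

section \<open>Summing over the residues\<close>

lemma sum_inverse_one_plus_square_le: "(\<Sum>k\<le>n. 1 / (1 + (real k)\<^sup>2 / 4)) \<le> 9"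
proof -
  have "(\<Sum>k\<le>Suc n. 1 / (1 + (real k)\<^sup>2 / 4)) \<le> 9 - 4 / real (Suc n)" for n
  proof (induction n)
    case (Suc n)
    define z where "z = real (Suc n)"
    have z: "z > 0" by (simp add: z_def)
    have "1 / (1 + (z + 1)\<^sup>2 / 4) = 4 / (4 + (z + 1)\<^sup>2)"
      using z by (simp add: field_simps)
    also have "\<dots> \<le> 4 / (z * (z + 1))"
      using z by (intro divide_left_mono) (auto simp: power2_eq_square algebra_simps intro!: mult_pos_pos add_pos_nonneg)
    also have "\<dots> = 4 / z - 4 / (z + 1)"
      using z by (simp add: field_simps)
    finally have "1 / (1 + (real (Suc (Suc n)))\<^sup>2 / 4) \<le> 4 / real (Suc n) - 4 / real (Suc (Suc n))"
      by (simp add: z_def add_ac)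
    then show ?case using Suc.IH unfolding sum.atMost_Suc[of _ "Suc n"] by linarith
  qed (simp add: power2_eq_square)
  from this[of n] have "(\<Sum>k\<le>Suc n. 1 / (1 + (real k)\<^sup>2 / 4)) \<le> 9" 
    by (smt (verit) divide_nonneg_nonneg of_nat_0_le_iff)
  moreover have "(\<Sum>k\<le>n. 1 / (1 + (real k)\<^sup>2 / 4)) \<le> (\<Sum>k\<le>Suc n. 1 / (1 + (real k)\<^sup>2 / 4))"
    by (intro sum_mono2) auto
  ultimately show ?thesis by linarith
qed

lemma exp_minus_le_inverse: "x \<ge> 0 \<Longrightarrow> exp (- x) \<le> 1 / (1 + x)" for x :: real
  using exp_ge_add_one_self[of x] by (simp add: exp_minus field_simps)

text \<open>
  The term of \<open>j\<close> decays like a Gaussian in the distance \<open>min j (n - j)\<close> of \<open>j\<close> from the multiples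
  of \<open>n\<close>, so the sum is bounded uniformly in \<open>n\<close>.
\<close>

lemma sum_exp_sin_pi_frac_le:
  fixes n :: nat
  assumes "n > 0"
  shows "(\<Sum>j<n. exp (- ((real n)\<^sup>2 / 8) * (sin (pi * real j / real n))\<^sup>2)) \<le> 18"
proof -
  define h where "h k = 1 / (1 + (real k)\<^sup>2 / 4)" for k :: nat
  have h0: "h k \<ge> 0" for k by (simp add: h_def)
  have "exp (- ((real n)\<^sup>2 / 8) * (sin (pi * real j / real n))\<^sup>2) \<le> h j + h (n - j)" if "j < n" for j
  proof -
    define k where "k = min j (n - j)"
    have "(3 * real k / (2 * real n))\<^sup>2 \<le> \<bar>sin (pi * real j / real n)\<bar>\<^sup>2"
      using that unfolding k_def by (intro power_mono abs_sin_pi_frac_ge) auto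
    then have "(real n)\<^sup>2 / 8 * (3 * real k / (2 * real n))\<^sup>2 \<le> (real n)\<^sup>2 / 8 * (sin (pi * real j / real n))\<^sup>2"
      by (intro mult_left_mono) auto
    moreover have "(real n)\<^sup>2 / 8 * (3 * real k / (2 * real n))\<^sup>2 = 9 / 32 * (real k)\<^sup>2"
      using assms by (simp add: power_divide power_mult_distrib)
    moreover have "0 \<le> (real k)\<^sup>2" by simp
    ultimately have "(real k)\<^sup>2 / 4 \<le> (real n)\<^sup>2 / 8 * (sin (pi * real j / real n))\<^sup>2" by linarith
    then have "exp (- ((real n)\<^sup>2 / 8) * (sin (pi * real j / real n))\<^sup>2) \<le> exp (- ((real k)\<^sup>2 / 4))" by simp
    also have "\<dots> \<le> h k" unfolding h_def by (intro exp_minus_le_inverse) auto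
    also have "\<dots> \<le> h j + h (n - j)" using h0 by (auto simp: k_def min_def)
    finally show ?thesis .
  qed
  then have "(\<Sum>j<n. exp (- ((real n)\<^sup>2 / 8) * (sin (pi * real j / real n))\<^sup>2)) \<le> (\<Sum>j<n. h j + h (n - j))"
    by (intro sum_mono) auto
  also have "\<dots> = (\<Sum>j<n. h j) + (\<Sum>j<n. h (n - j))" by (rule sum.distrib)
  also have "(\<Sum>j<n. h j) \<le> (\<Sum>j\<le>n. h j)" by (intro sum_mono2) (auto simp: h0)
  also have "(\<Sum>j<n. h (n - j)) = sum h ((\<lambda>j. n - j) ` {..<n})"
    by (subst sum.reindex) (auto simp: inj_on_def)
  also have "\<dots> \<le> (\<Sum>j\<le>n. h j)" by (intro sum_mono2) (auto simp: h0)
  finally show ?thesis using sum_inverse_one_plus_square_le[of n] unfolding h_def by simp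
qed

text \<open>
  Doubling maps \<open>{..<n}\<close> injectively into two periods of the sum without the factor two, so the bound
  doubles. For even \<open>n\<close> every value is indeed taken twice, because the parity of the walk is then
  deterministic.
\<close>

lemma sum_exp_sin_two_pi_frac_le:
  fixes n :: nat
  assumes "n > 0"
  shows "(\<Sum>j<n. exp (- ((real n)\<^sup>2 / 8) * (sin (2 * pi * real j / real n))\<^sup>2)) \<le> 36"
proof -
  define f where "f l = exp (- ((real n)\<^sup>2 / 8) * (sin (pi * real l / real n))\<^sup>2)" for l :: nat
  have per: "f (j + n) = f j" for j
  proof -
    have "pi * real (j + n) / real n = pi * real j / real n + pi" using assms by (simp add: field_simps)
    then show ?thesis by (simp add: f_def)
  qed
  have "(\<Sum>j<n. exp (- ((real n)\<^sup>2 / 8) * (sin (2 * pi * real j / real n))\<^sup>2)) = (\<Sum>j<n. f (2 * j))"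
    by (simp add: f_def mult_ac)
  also have "\<dots> = sum f ((*) 2 ` {..<n})" by (subst sum.reindex) (auto simp: inj_on_def)
  also have "\<dots> \<le> sum f {..<n + n}" by (intro sum_mono2) (auto simp: f_def)
  also have "{..<n + n} = {..<n} \<union> {n..<n + n}" by auto
  also have "sum f ({..<n} \<union> {n..<n + n}) = sum f {..<n} + sum f {n..<n + n}"
    by (rule sum.union_disjoint) auto
  also have "sum f {n..<n + n} = (\<Sum>j<n. f (j + n))"
    using sum.shift_bounds_nat_ivl[of f 0 n n] by (simp add: atLeast0LessThan)
  also have "\<dots> = sum f {..<n}" by (simp add: per)
  finally show ?thesis using sum_exp_sin_pi_frac_le[OF assms] by (simp add: f_def)
qed

lemma sum_coprime_multiple:
  fixes f :: "nat \<Rightarrow> real" and m n :: nat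
  assumes "coprime m n" and per: "\<And>l. f (l mod n) = f l"
  shows "(\<Sum>j<n. f (j * m)) = (\<Sum>j<n. f j)"
proof (cases "n = 0")
  case False
  have inj: "inj_on (\<lambda>j. (j * m) mod n) {..<n}"
  proof (rule inj_onI)
    fix x y assume xy: "x \<in> {..<n}" "y \<in> {..<n}" "(x * m) mod n = (y * m) mod n"
    then have "[x * m = y * m] (mod n)" by (simp add: cong_def)
    then have "[x = y] (mod n)" using assms(1) by (metis cong_mult_rcancel_nat mult.commute)
    then show "x = y" using xy by (simp add: cong_def)
  qed
  moreover have "(\<lambda>j. (j * m) mod n) ` {..<n} \<subseteq> {..<n}" using False by auto
  ultimately have img: "(\<lambda>j. (j * m) mod n) ` {..<n} = {..<n}"
    by (intro card_subset_eq) (auto simp: card_image)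
  have "(\<Sum>j<n. f (j * m)) = (\<Sum>j<n. f ((j * m) mod n))" by (simp add: per)
  also have "\<dots> = sum f ((\<lambda>j. (j * m) mod n) ` {..<n})" using inj by (simp add: sum.reindex)
  finally show ?thesis by (simp add: img)
qed simp

text \<open>
  Jensen's inequality for the exponential function replaces the product over the steps by an average
  over \<open>i\<close> of the sums in which every step equals \<open>a i\<close>; as \<open>a i\<close> is a unit mod \<open>n\<close>, each of these is
  the sum for the step \<open>1\<close>.
\<close>

lemma sum_exp_coprime_steps_le:
  fixes n :: nat and a :: "nat \<Rightarrow> nat"
  assumes "finite J" "\<And>i. i \<in> J \<Longrightarrow> coprime (a i) n" "card J \<ge> 2 * n\<^sup>2" "n > 0"
  shows "(\<Sum>j<n. exp (- (\<Sum>i\<in>J. (sin (2 * pi * real (j * a i) / real n))\<^sup>2) / 16)) \<le> 36"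
proof -
  define W where "W = real (card J)"
  define S where "S l = (sin (2 * pi * real l / real n))\<^sup>2" for l :: nat
  have "2 * (real n)\<^sup>2 \<le> W"
    using assms(3) unfolding W_def by (metis of_nat_le_iff of_nat_mult of_nat_numeral of_nat_power)
  then have W: "(real n)\<^sup>2 / 8 \<le> W / 16" "W > 0" using assms(4)
    by (simp_all add: zero_less_power less_le_trans[of 0 "2 * (real n)\<^sup>2"])
  have S_per: "S (l mod n) = S l" for l
  proof -
    have "real l = real n * real (l div n) + real (l mod n)"
      by (metis mult_div_mod_eq of_nat_add of_nat_mult)
    then have "2 * pi * real l / real n = 2 * pi * real (l mod n) / real n + 2 * real (l div n) * pi"
      using assms by (simp add: field_simps)
    then have "sin (2 * pi * real l / real n) = sin (2 * pi * real (l mod n) / real n)"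
      by (simp add: sin_add)
    then show ?thesis by (simp add: S_def)
  qed
  have jensen: "exp (- (\<Sum>i\<in>J. S (j * a i)) / 16) \<le> (\<Sum>i\<in>J. (1 / W) * exp (- (real n)\<^sup>2 / 8 * S (j * a i)))" for j
  proof -
    have "exp (- (\<Sum>i\<in>J. S (j * a i)) / 16) = exp (\<Sum>i\<in>J. (1 / W) *\<^sub>R (- W / 16 * S (j * a i)))"
      using W by (simp add: sum_negf sum_divide_distrib)
    also have "\<dots> \<le> (\<Sum>i\<in>J. (1 / W) * exp (- W / 16 * S (j * a i)))"
      using W assms(1) by (intro convex_on_sum[OF _ _ exp_convex]) (auto simp: W_def)
    also have "\<dots> \<le> (\<Sum>i\<in>J. (1 / W) * exp (- (real n)\<^sup>2 / 8 * S (j * a i)))"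
    proof (intro sum_mono mult_left_mono)
      fix i
      have "(real n)\<^sup>2 / 8 * S (j * a i) \<le> W / 16 * S (j * a i)"
        using W by (intro mult_right_mono) (auto simp: S_def)
      then show "exp (- W / 16 * S (j * a i)) \<le> exp (- (real n)\<^sup>2 / 8 * S (j * a i))" by simp
    qed (use W in auto)
    finally show ?thesis .
  qed
  have "(\<Sum>j<n. exp (- (\<Sum>i\<in>J. S (j * a i)) / 16))
      \<le> (\<Sum>j<n. \<Sum>i\<in>J. (1 / W) * exp (- (real n)\<^sup>2 / 8 * S (j * a i)))"
    by (intro sum_mono jensen)
  also have "\<dots> = (\<Sum>i\<in>J. (1 / W) * (\<Sum>j<n. exp (- (real n)\<^sup>2 / 8 * S (j * a i))))"
    by (subst sum.swap) (simp add: sum_distrib_left)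
  also have "\<dots> \<le> (\<Sum>i\<in>J. (1 / W) * 36)"
  proof (intro sum_mono mult_left_mono)
    fix i assume "i \<in> J"
    then have "(\<Sum>j<n. exp (- (real n)\<^sup>2 / 8 * S (j * a i))) = (\<Sum>j<n. exp (- (real n)\<^sup>2 / 8 * S j))"
      using assms by (intro sum_coprime_multiple[where f = "\<lambda>l. exp (- (real n)\<^sup>2 / 8 * S l)"]) (auto simp: S_per)
    then show "(\<Sum>j<n. exp (- (real n)\<^sup>2 / 8 * S (j * a i))) \<le> 36"
      using sum_exp_sin_two_pi_frac_le[OF assms(4)] by (simp add: S_def)
  qed (use W in auto)
  also have "\<dots> = 36" using W by (simp add: W_def)
  finally show ?thesis by (simp add: S_def)
qed

section \<open>Anticoncentration in a residue class\<close>

lemma sum_cos_residues: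
  fixes n :: nat and y :: int
  assumes "n > 0"
  shows "(\<Sum>j<n. cos (2 * pi * real j / real n * of_int y)) = (if int n dvd y then real n else 0)"
proof (cases "int n dvd y")
  case True
  then obtain k where k: "y = int n * k" by (elim dvdE)
  have "cos (2 * pi * real j / real n * of_int y) = 1" for j
  proof -
    have "2 * pi * real j / real n * of_int y = 2 * pi * of_int (int j * k)"
      using assms by (simp add: k field_simps)
    then show ?thesis by (metis cos_int_2pin)
  qed
  then show ?thesis using True by simp
next
  case False
  define w where "w = 2 * pi * of_int y / real n"
  have "real n * w = 2 * pi * of_int y" using assms by (simp add: w_def)
  then have "cis w ^ n = cis (2 * pi * of_int y)" by (simp only: Complex.DeMoivre)
  also have "\<dots> = 1" by (simp add: cis_multiple_2pi)
  finally have pow: "cis w ^ n = 1" .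
  have "cis w \<noteq> 1"
  proof
    assume "cis w = 1"
    then have "cos w = 1" by (metis cis.simps(1) one_complex.simps(1))
    then obtain k :: int where "w = of_int k * (2 * pi)" by (auto simp: cos_one_2pi_int)
    then have "of_int y = (of_int (int n * k) :: real)"
      using assms by (simp add: w_def field_simps)
    then have "y = int n * k" by (simp only: of_int_eq_iff)
    then show False using False by simp
  qed
  then have "(\<Sum>j<n. cis w ^ j) = 0"
    using pow by (simp add: sum_gp_strict)
  then have "Re (\<Sum>j<n. cis w ^ j) = 0" by simp
  then have "(\<Sum>j<n. cos (real j * w)) = 0" by (simp add: Complex.DeMoivre)
  then show ?thesis using False by (simp add: w_def field_simps)
qed

text \<open>
  For \<open>y \<noteq> 0\<close> this is the Fejer kernel \<open>(1 - cos y) / y\<^sup>2\<close>, written in the form that exhibits its compactly supported Fourier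
  transform.
\<close>

definition fejer :: "real \<Rightarrow> real" where
  "fejer y = integral {0..1} (\<lambda>u. (1 - u) * cos (u * y))"

lemma fejer_integrable: "(\<lambda>u. (1 - u) * cos (u * y)) integrable_on {0..1::real}"
  by (intro integrable_continuous_interval continuous_intros)

lemma fejer_nonneg: "0 \<le> fejer y"
proof (cases "y = 0")
  case True
  then show ?thesis unfolding fejer_def
    by (intro integral_nonneg fejer_integrable) auto
next
  case False
  let ?F = "\<lambda>u. (1 - u) * sin (u * y) / y - cos (u * y) / y\<^sup>2"
  have "((\<lambda>u. (1 - u) * cos (u * y)) has_integral (?F 1 - ?F 0)) {0..1}"
    by (rule fundamental_theorem_of_calculus)
       (use False in \<open>auto intro!: derivative_eq_intros
          simp: has_real_derivative_iff_has_vector_derivative[symmetric] field_simps power2_eq_square\<close>)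
  then have "fejer y = (1 - cos y) / y\<^sup>2"
    by (simp add: fejer_def integral_unique diff_divide_distrib)
  then show ?thesis by simp
qed

lemma fejer_ge_quarter:
  assumes "\<bar>y\<bar> \<le> 1"
  shows "1 / 4 \<le> fejer y"
proof -
  have "((\<lambda>u. (1 - u) / 2) has_integral ((1 - 1\<^sup>2 / 2) / 2 - (0 - 0\<^sup>2 / 2) / 2)) {0..1::real}"
    by (rule fundamental_theorem_of_calculus)
       (auto intro!: derivative_eq_intros simp: has_real_derivative_iff_has_vector_derivative[symmetric])
  then have half: "((\<lambda>u. (1 - u) / 2) has_integral 1 / 4) {0..1::real}" by simp
  show ?thesis
    unfolding fejer_def
  proof (rule has_integral_le[OF half integrable_integral[OF fejer_integrable]])
    fix u :: real assume u: "u \<in> {0..1}"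
    have "\<bar>u * y\<bar> \<le> 1 * 1" unfolding abs_mult using u assms by (intro mult_mono) auto
    then have "(u * y)\<^sup>2 \<le> 1" by (simp add: abs_square_le_1)
    then have "1 / 2 \<le> cos (u * y)" using cos_ge_one_minus_half_square[of "u * y"] by linarith
    then have "(1 - u) * (1 / 2) \<le> (1 - u) * cos (u * y)" using u by (intro mult_left_mono) auto
    then show "(1 - u) / 2 \<le> (1 - u) * cos (u * y)" by simp
  qed
qed

text \<open>
  Replacing \<open>exp (- x\<^sup>2)\<close> by the larger \<open>1 / (1 + x\<^sup>2)\<close> makes the integral over the window frequencies
  elementary and costs only a constant.
\<close>

lemma integral_cauchy_density:
  assumes "r > (0::real)"
  shows "((\<lambda>u. 1 / (1 + (r * u)\<^sup>2)) has_integral arctan r / r) {0..1}"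
proof -
  have "((\<lambda>u. arctan (r * u) / r) has_real_derivative 1 / (1 + (r * u)\<^sup>2)) (at u within {0..1})" for u
    using assms by (auto intro!: derivative_eq_intros simp: divide_inverse)
  then have "((\<lambda>u. 1 / (1 + (r * u)\<^sup>2)) has_integral (arctan (r * 1) / r - arctan (r * 0) / r)) {0..1}"
    by (intro fundamental_theorem_of_calculus)
       (auto simp: has_real_derivative_iff_has_vector_derivative[symmetric])
  then show ?thesis by simp
qed

text \<open>
  The indicator of the event is at most four times the product of the indicator of the residue class,
  which is the mean of the characters \<open>cos (2 * pi * j * y / n)\<close>, and the Fejer kernel at scale
  \<open>R\<close>. The expectation of the product is a combination of characteristic functions at the
  frequencies \<open>2 * pi * j / n + t / R\<close> with \<open>\<bar>t\<bar> \<le> 1\<close>. Only the steps in \<open>I\<close> are used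
  to bound them; the cosines of the other steps are bounded by one. The constant is \<open>4 * 36 * 7\<close>: the
  first factor comes from the kernel, the second from the sum over \<open>j\<close>, the third from the integral
  over \<open>t\<close>.
\<close>

lemma anticoncentration_mod:
  fixes a :: "nat \<Rightarrow> nat" and p q N n :: nat and c :: int and R \<sigma> :: real
  assumes I: "I \<subseteq> {q..<q+N}" "\<And>i. i \<in> I \<Longrightarrow> a i < n"
    and J: "card {i\<in>I. coprime (a i) n} \<ge> 2 * n\<^sup>2"
    and n: "n > 0"
    and \<sigma>: "\<sigma> > 0" "\<sigma>\<^sup>2 = (\<Sum>i\<in>I. (real (a i))\<^sup>2)"
    and R: "2 * (real n)\<^sup>2 \<le> R"
  shows "sign_avg N (\<lambda>s. of_bool (int n dvd signed_sum a q s - c \<and> \<bar>of_int (signed_sum a q s - c)\<bar> \<le> R))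
          \<le> 1008 * R / (real n * \<sigma>)"
proof -
  define Y where "Y s = signed_sum a q s - c" for s
  define \<theta> where "\<theta> j = 2 * pi * real j / real n" for j :: nat
  define S where "S j = (\<Sum>i\<in>I. (sin (2 * pi * real (j * a i) / real n))\<^sup>2)" for j :: nat
  define r where "r = \<sigma> / (4 * R)"
  have fin: "finite I" using I(1) by (rule finite_subset) auto
  have "0 < 2 * (real n)\<^sup>2" using n by simp
  with R have R0: "R > 0" by linarith
  have r: "r > 0" using \<sigma> R0 by (simp add: r_def)

  \<comment> \<open>The factor 4 in the definition of r absorbs the constant 16 of the cosine bound.\<close>
  have char: "\<bar>sign_avg N (\<lambda>s. cos ((\<theta> j + t / R) * of_int (Y s)))\<bar> \<le> exp (- S j / 16) / (1 + (r * t)\<^sup>2)"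
    if t: "\<bar>t\<bar> \<le> 1" for j t
  proof -
    let ?c = "\<lambda>i. cos ((\<theta> j + t / R) * real (a i))"
    have "\<bar>t / R\<bar> \<le> 1 / R" using t R0 by (simp add: divide_right_mono)
    then have "2 * (real n)\<^sup>2 * \<bar>t / R\<bar> \<le> R * (1 / R)" using R R0 by (intro mult_mono) auto
    then have tR: "2 * (real n)\<^sup>2 * \<bar>t / R\<bar> \<le> 1" using R0 by simp
    have "sign_avg N (\<lambda>s. cos ((\<theta> j + t / R) * of_int (Y s)))
        = cos ((\<theta> j + t / R) * of_int (- c)) * (\<Prod>i\<in>{q..<q+N}. ?c i)"
      using sign_avg_cos_signed_sum[of N "\<theta> j + t / R" "of_int (- c)" a q] by (simp add: Y_def)
    also have "\<bar>\<dots>\<bar> \<le> 1 * (\<Prod>i\<in>{q..<q+N}. \<bar>?c i\<bar>)"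
      unfolding abs_mult abs_prod by (intro mult_mono prod_nonneg) auto
    also have "(\<Prod>i\<in>{q..<q+N}. \<bar>?c i\<bar>) = (\<Prod>i\<in>{q..<q+N} - I. \<bar>?c i\<bar>) * (\<Prod>i\<in>I. \<bar>?c i\<bar>)"
      by (rule prod.subset_diff) (use I in auto)
    also have "\<dots> \<le> 1 * (\<Prod>i\<in>I. exp (- ((sin (2 * pi * real (j * a i) / real n))\<^sup>2 + (t / R * real (a i))\<^sup>2) / 16))"
      unfolding \<theta>_def using I(2) tR
      by (intro mult_mono prod_mono prod_le_1 conjI abs_cos_near_fraction_le prod_nonneg) auto
    also have "\<dots> = exp (\<Sum>i\<in>I. - ((sin (2 * pi * real (j * a i) / real n))\<^sup>2 + (t / R * real (a i))\<^sup>2) / 16)"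
      using fin by (simp add: exp_sum)
    also have "(\<Sum>i\<in>I. - ((sin (2 * pi * real (j * a i) / real n))\<^sup>2 + (t / R * real (a i))\<^sup>2) / 16)
        = - S j / 16 - (t / R)\<^sup>2 * (\<Sum>i\<in>I. (real (a i))\<^sup>2) / 16"
      unfolding S_def power_mult_distrib
      by (simp add: sum_divide_distrib[symmetric] sum_subtractf sum_negf sum_distrib_left[symmetric] diff_divide_distrib)
    also have "\<dots> = - S j / 16 + (- (r * t)\<^sup>2)"
      using R0 by (simp add: \<sigma>(2)[symmetric] r_def power_divide power_mult_distrib mult_ac)
    also have "exp \<dots> = exp (- S j / 16) * exp (- (r * t)\<^sup>2)" by (rule exp_add)
    also have "\<dots> \<le> exp (- S j / 16) * (1 / (1 + (r * t)\<^sup>2))"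
      by (intro mult_left_mono exp_minus_le_inverse) auto
    finally show ?thesis by simp
  qed

  define f where "f j s u = cos (\<theta> j * of_int (Y s)) * ((1 - u) * cos (u * (of_int (Y s) / R)))"
    for j s and u :: real
  have f_int: "(\<lambda>u. f j s u) integrable_on {0..1}" for j s
    unfolding f_def by (intro integrable_on_mult_right fejer_integrable)
  have f_fejer: "integral {0..1} (\<lambda>u. f j s u) = cos (\<theta> j * of_int (Y s)) * fejer (of_int (Y s) / R)" for j s
    unfolding f_def fejer_def by (rule integral_mult_right)
  have detect: "of_bool (int n dvd Y s \<and> \<bar>of_int (Y s)\<bar> \<le> R)
      \<le> 4 / real n * (\<Sum>j<n. integral {0..1} (\<lambda>u. f j s u))" for s
  proof -
    have "(\<Sum>j<n. integral {0..1} (\<lambda>u. f j s u)) = (if int n dvd Y s then real n else 0) * fejer (of_int (Y s) / R)"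
      unfolding f_fejer sum_distrib_right[symmetric] \<theta>_def sum_cos_residues[OF n] ..
    moreover have "1 / 4 \<le> fejer (of_int (Y s) / R)" if "\<bar>of_int (Y s)\<bar> \<le> R"
      using that R0 by (intro fejer_ge_quarter) (simp add: divide_le_eq)
    ultimately show ?thesis using n fejer_nonneg[of "of_int (Y s) / R"] by auto
  qed
  have frequency: "integral {0..1} (\<lambda>u. sign_avg N (\<lambda>s. f j s u)) \<le> exp (- S j / 16) * (7 * R / \<sigma>)" for j
  proof -
    have "integral {0..1} (\<lambda>u. sign_avg N (\<lambda>s. f j s u)) \<le> exp (- S j / 16) * (arctan r / r)"
    proof (rule has_integral_le)
      show "((\<lambda>u. sign_avg N (\<lambda>s. f j s u)) has_integral integral {0..1} (\<lambda>u. sign_avg N (\<lambda>s. f j s u))) {0..1}"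
        using f_int by (intro integrable_integral sign_avg_integral(2))
      show "((\<lambda>u. exp (- S j / 16) * (1 / (1 + (r * u)\<^sup>2))) has_integral exp (- S j / 16) * (arctan r / r)) {0..1}"
        by (intro has_integral_mult_right integral_cauchy_density r)
    next
      fix u :: real assume u: "u \<in> {0..1}"
      let ?A = "sign_avg N (\<lambda>s. cos ((\<theta> j + u / R) * of_int (Y s)))"
      let ?B = "sign_avg N (\<lambda>s. cos ((\<theta> j + (- u) / R) * of_int (Y s)))"
      let ?b = "exp (- S j / 16) / (1 + (r * u)\<^sup>2)"
      have "f j s u = (1 - u) / 2 * (cos ((\<theta> j + u / R) * of_int (Y s)) + cos ((\<theta> j + (- u) / R) * of_int (Y s)))" for s
        by (simp add: f_def cos_add cos_diff algebra_simps)
      then have "sign_avg N (\<lambda>s. f j s u) = (1 - u) / 2 * (?A + ?B)"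
        by (simp only: sign_avg_cmult sign_avg_add)
      also have "\<dots> \<le> (1 - u) / 2 * (?b + ?b)"
        using char[of u j] char[of "- u" j] u by (intro mult_left_mono add_mono) auto
      also have "\<dots> = (1 - u) * ?b" by simp
      also have "\<dots> \<le> 1 * ?b" using u by (intro mult_right_mono) (auto intro: divide_nonneg_nonneg)
      finally show "sign_avg N (\<lambda>s. f j s u) \<le> exp (- S j / 16) * (1 / (1 + (r * u)\<^sup>2))" by simp
    qed
    \<comment> \<open>The arctangent is below pi / 2 < 7 / 4.\<close>
    also have "\<dots> \<le> exp (- S j / 16) * ((7 / 4) / r)"
      using arctan_ubound[of r] pi_approx r by (intro mult_left_mono divide_right_mono) auto
    also have "(7 / 4) / r = 7 * R / \<sigma>" using R0 \<sigma> by (simp add: r_def)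
    finally show ?thesis .
  qed
  have mixing: "(\<Sum>j<n. exp (- S j / 16)) \<le> 36"
  proof -
    let ?J = "{i\<in>I. coprime (a i) n}"
    have "(\<Sum>j<n. exp (- S j / 16))
        \<le> (\<Sum>j<n. exp (- (\<Sum>i\<in>?J. (sin (2 * pi * real (j * a i) / real n))\<^sup>2) / 16))"
    proof (intro sum_mono)
      fix j
      have "(\<Sum>i\<in>?J. (sin (2 * pi * real (j * a i) / real n))\<^sup>2) \<le> S j"
        unfolding S_def using fin by (intro sum_mono2) auto
      then show "exp (- S j / 16) \<le> exp (- (\<Sum>i\<in>?J. (sin (2 * pi * real (j * a i) / real n))\<^sup>2) / 16)"
        by simp
    qed
    also have "\<dots> \<le> 36"
      using fin J n by (intro sum_exp_coprime_steps_le) auto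
    finally show ?thesis .
  qed
  have "sign_avg N (\<lambda>s. of_bool (int n dvd Y s \<and> \<bar>of_int (Y s)\<bar> \<le> R))
      \<le> sign_avg N (\<lambda>s. 4 / real n * (\<Sum>j<n. integral {0..1} (\<lambda>u. f j s u)))"
    by (intro sign_avg_mono detect)
  also have "\<dots> = 4 / real n * (\<Sum>j<n. integral {0..1} (\<lambda>u. sign_avg N (\<lambda>s. f j s u)))"
    unfolding sign_avg_cmult sign_avg_sum using f_int by (subst sign_avg_integral(1)) auto
  also have "\<dots> \<le> 4 / real n * (\<Sum>j<n. exp (- S j / 16) * (7 * R / \<sigma>))"
    by (intro mult_left_mono sum_mono frequency) auto
  also have "\<dots> = 4 / real n * ((\<Sum>j<n. exp (- S j / 16)) * (7 * R / \<sigma>))"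
    unfolding sum_distrib_right ..
  also have "\<dots> \<le> 4 / real n * (36 * (7 * R / \<sigma>))"
    using R0 \<sigma> by (intro mult_left_mono mult_right_mono mixing) auto
  also have "\<dots> = 1008 * R / (real n * \<sigma>)" by simp
  finally show ?thesis by (simp add: Y_def)
qed

section \<open>A Bertrand series\<close>

text \<open>
  Cauchy condensation needs a decreasing sequence. As \<open>1 / ln 1\<close> is \<open>0\<close> by convention, the terms with
  \<open>ln n\<close> increase at the start; the shifted logarithm \<open>ln (n + 1)\<close>, at most \<open>2 * ln n\<close>, avoids this.
\<close>

lemma summable_bertrand: "summable (\<lambda>n. 1 / (real n * ln (real n) powr (3/2)))"
proof -
  define f where "f n = 1 / (real n * ln (real n + 1) powr (3/2))" for n :: nat
  have "summable f \<longleftrightarrow> summable (\<lambda>n. 2 ^ n * f (2 ^ n))"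
  proof (rule condensation_test)
    fix m :: nat assume "0 < m"
    then show "f (Suc m) \<le> f m" unfolding f_def
      by (intro divide_left_mono mult_mono powr_mono2 mult_pos_pos) auto
  qed (auto simp: f_def)
  moreover have "summable (\<lambda>n. 2 ^ n * f (2 ^ n))"
  proof (rule summable_comparison_test)
    show "summable (\<lambda>n. real n powr (-(3/2)) / ln 2 powr (3/2))"
      by (intro summable_divide) (simp add: summable_real_powr_iff)
    show "\<exists>N. \<forall>n\<ge>N. norm (2 ^ n * f (2 ^ n)) \<le> real n powr (-(3/2)) / ln 2 powr (3/2)"
    proof (intro exI[of _ 1] allI impI)
      fix n :: nat assume n: "n \<ge> 1"
      have "real n * ln 2 = ln (2 ^ n)" by (simp add: ln_realpow)
      also have "\<dots> \<le> ln (2 ^ n + 1)" by (intro ln_mono) auto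
      finally have "(real n * ln 2) powr (3/2) \<le> ln (2 ^ n + 1) powr (3/2)"
        by (intro powr_mono2) auto
      then have "1 / ln (2 ^ n + 1) powr (3/2) \<le> 1 / (real n * ln 2) powr (3/2)"
        using n by (intro divide_left_mono mult_pos_pos) auto
      also have "\<dots> = real n powr (-(3/2)) / ln 2 powr (3/2)"
        by (simp add: powr_mult powr_minus_divide)
      finally show "norm (2 ^ n * f (2 ^ n)) \<le> real n powr (-(3/2)) / ln 2 powr (3/2)"
        by (simp add: f_def)
    qed
  qed
  ultimately have f: "summable f" by simp
  show ?thesis
  proof (rule summable_comparison_test)
    show "summable (\<lambda>n. 2 powr (3/2) * f n)" using f by (rule summable_mult)
    show "\<exists>N. \<forall>n\<ge>N. norm (1 / (real n * ln (real n) powr (3/2))) \<le> 2 powr (3/2) * f n"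
    proof (intro exI[of _ 2] allI impI)
      fix n :: nat assume n: "n \<ge> 2"
      have "n + 1 \<le> n * n" using n mult_le_mono[of 2 n n n] by linarith
      then have "real n + 1 \<le> (real n)\<^sup>2" unfolding power2_eq_square by (metis of_nat_1 of_nat_add of_nat_le_iff of_nat_mult)
      then have "ln (real n + 1) \<le> ln ((real n)\<^sup>2)" by (intro ln_mono) auto
      also have "\<dots> = 2 * ln (real n)" using n by (simp add: ln_realpow)
      finally have "ln (real n + 1) powr (3/2) \<le> (2 * ln (real n)) powr (3/2)"
        by (intro powr_mono2) auto
      also have "\<dots> = 2 powr (3/2) * ln (real n) powr (3/2)" using n by (simp add: powr_mult)
      finally have *: "ln (real n + 1) powr (3/2) \<le> 2 powr (3/2) * ln (real n) powr (3/2)" .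
      have "ln (real n) powr (3/2) > 0" "ln (real n + 1) powr (3/2) > 0" using n by auto
      then show "norm (1 / (real n * ln (real n) powr (3/2))) \<le> 2 powr (3/2) * f n"
        using * n by (simp add: f_def field_simps)
    qed
  qed
qed

section \<open>From sign patterns to the random walk\<close>

definition sign_list :: "(nat \<Rightarrow> 'a \<Rightarrow> real) \<Rightarrow> nat \<Rightarrow> 'a \<Rightarrow> bool list" where
  "sign_list \<epsilon> n \<omega> = map (\<lambda>k. \<epsilon> k \<omega> = 1) [1..<Suc n]"

lemma length_sign_list [simp]: "length (sign_list \<epsilon> n \<omega>) = n"
  by (simp add: sign_list_def)

lemma take_sign_list: "k \<le> n \<Longrightarrow> take k (sign_list \<epsilon> n \<omega>) = sign_list \<epsilon> k \<omega>"
  by (simp add: sign_list_def take_map take_upt del: upt_Suc)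

lemma signed_sum_append:
  "signed_sum a q (s @ [b]) = signed_sum a q s + (if b then int (a (q + length s)) else - int (a (q + length s)))"
  by (induction s arbitrary: q) auto

lemma rademacher_walk_eq_signed_sum:
  assumes "\<And>k. k \<ge> 1 \<Longrightarrow> \<epsilon> k \<omega> = 1 \<or> \<epsilon> k \<omega> = -1"
  shows "rademacher_walk \<epsilon> (\<lambda>i. real (a i)) n \<omega> = of_int (signed_sum a 1 (sign_list \<epsilon> n \<omega>))"
proof (induction n)
  case (Suc n)
  have "sign_list \<epsilon> (Suc n) \<omega> = sign_list \<epsilon> n \<omega> @ [\<epsilon> (Suc n) \<omega> = 1]"
    by (simp add: sign_list_def)
  then show ?case
    using Suc.IH assms[of "Suc n"] by (auto simp: rademacher_walk_def signed_sum_append)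
qed (simp add: rademacher_walk_def sign_list_def)

lemma rademacher_AE_sign:
  assumes "rademacher_sequence M \<epsilon>"
  shows "AE \<omega> in M. \<forall>k\<ge>1. \<epsilon> k \<omega> = 1 \<or> \<epsilon> k \<omega> = -1"
proof -
  interpret prob_space M using assms by (simp add: rademacher_sequence_def)
  have indep: "indep_vars (\<lambda>_. borel) \<epsilon> {1..}" using assms by (simp add: rademacher_sequence_def)
  have "AE \<omega> in M. k \<ge> 1 \<longrightarrow> \<epsilon> k \<omega> = 1 \<or> \<epsilon> k \<omega> = -1" for k
  proof (cases "k \<ge> 1")
    case True
    then have [measurable]: "\<epsilon> k \<in> borel_measurable M"
      using indep by (auto simp: indep_vars_def2)
    have "prob ({\<omega> \<in> space M. \<epsilon> k \<omega> = 1} \<union> {\<omega> \<in> space M. \<epsilon> k \<omega> = -1})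
        = prob {\<omega> \<in> space M. \<epsilon> k \<omega> = 1} + prob {\<omega> \<in> space M. \<epsilon> k \<omega> = -1}"
      by (intro finite_measure_Union) auto
    also have "\<dots> = 1 / 2 + 1 / 2"
      using assms True unfolding rademacher_sequence_def by (intro arg_cong2[where f = "(+)"]) blast+
    also have "\<dots> = 1" by simp
    finally have "AE \<omega> in M. \<omega> \<in> {\<omega> \<in> space M. \<epsilon> k \<omega> = 1} \<union> {\<omega> \<in> space M. \<epsilon> k \<omega> = -1}"
      by (subst prob_eq_1[symmetric]) auto
    then show ?thesis by (rule AE_mp) (auto intro!: AE_I2)
  qed auto
  then show ?thesis by (simp add: AE_all_countable)
qed

text \<open>
  Independence makes all sign patterns equally likely. Encoding a sign as the truth value of
  \<open>\<epsilon> k \<omega> = 1\<close> makes the sign pattern a map to a finite set on all of the space, so that every property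
  of patterns gives a measurable event.
\<close>

lemma prob_sign_list:
  assumes "rademacher_sequence M \<epsilon>"
  shows "{\<omega> \<in> space M. P (sign_list \<epsilon> N \<omega>)} \<in> sets M" (is "?A P \<in> _")
    and "measure M {\<omega> \<in> space M. P (sign_list \<epsilon> N \<omega>)} = sign_avg N (\<lambda>s. of_bool (P s))"
proof -
  interpret prob_space M using assms by (simp add: rademacher_sequence_def)
  have indep: "indep_vars (\<lambda>_. borel) \<epsilon> {1..}" using assms by (simp add: rademacher_sequence_def)
  have meas [measurable]: "\<epsilon> k \<in> borel_measurable M" if "k \<ge> 1" for k
    using indep that by (auto simp: indep_vars_def2)
  have single: "{\<omega> \<in> space M. sign_list \<epsilon> N \<omega> = s} \<in> sets M \<and> prob {\<omega> \<in> space M. sign_list \<epsilon> N \<omega> = s} = 1 / 2 ^ N"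
    if len: "length s = N" for s
  proof (cases "N = 0")
    case True
    then have "{\<omega> \<in> space M. sign_list \<epsilon> N \<omega> = s} = space M" using len by (auto simp: sign_list_def)
    then show ?thesis using True by (simp add: prob_space)
  next
    case False
    define V where "V k = (if s ! (k - 1) then {1} else - {1 :: real})" for k :: nat
    have V: "V k \<in> sets borel" for k by (simp add: V_def)
    have "sign_list \<epsilon> N \<omega> = s \<longleftrightarrow> (\<forall>k\<in>{1..N}. \<epsilon> k \<omega> \<in> V k)" for \<omega>
    proof -
      have "sign_list \<epsilon> N \<omega> = s \<longleftrightarrow> (\<forall>i<N. (\<epsilon> (Suc i) \<omega> = 1) = s ! i)"
        using len by (auto simp: list_eq_iff_nth_eq sign_list_def simp del: upt_Suc)
      also have "\<dots> \<longleftrightarrow> (\<forall>k\<in>Suc ` {..<N}. \<epsilon> k \<omega> \<in> V k)"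
        by (auto simp: V_def)
      finally show ?thesis by (simp add: image_Suc_lessThan)
    qed
    then have eq: "{\<omega> \<in> space M. sign_list \<epsilon> N \<omega> = s} = (\<Inter>k\<in>{1..N}. \<epsilon> k -` V k \<inter> space M)"
      using False by auto
    have V_half: "prob (\<epsilon> k -` V k \<inter> space M) = 1 / 2" if "k \<in> {1..N}" for k
    proof -
      have half: "prob {\<omega> \<in> space M. \<epsilon> k \<omega> = 1} = 1 / 2"
        using assms that by (simp add: rademacher_sequence_def)
      have [measurable]: "\<epsilon> k \<in> borel_measurable M" using that meas by auto
      have "prob (space M - {\<omega> \<in> space M. \<epsilon> k \<omega> = 1}) = 1 / 2"
        by (subst prob_compl) (auto simp: half)
      moreover have "\<epsilon> k -` V k \<inter> space M = (if s ! (k - 1) then {\<omega> \<in> space M. \<epsilon> k \<omega> = 1}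
          else space M - {\<omega> \<in> space M. \<epsilon> k \<omega> = 1})"
        by (auto simp: V_def)
      ultimately show ?thesis by (simp add: half)
    qed
    have "prob (\<Inter>k\<in>{1..N}. \<epsilon> k -` V k \<inter> space M) = (\<Prod>k\<in>{1..N}. prob (\<epsilon> k -` V k \<inter> space M))"
      using False V by (intro indep_varsD[OF indep]) auto
    also have "\<dots> = 1 / 2 ^ N" by (simp add: V_half power_one_over)
    finally have "prob {\<omega> \<in> space M. sign_list \<epsilon> N \<omega> = s} = 1 / 2 ^ N" by (simp add: eq)
    moreover have "{\<omega> \<in> space M. sign_list \<epsilon> N \<omega> = s} \<in> sets M"
      unfolding eq
    proof (intro sets.finite_INT)
      show "\<epsilon> k -` V k \<inter> space M \<in> sets M" if "k \<in> {1..N}" for k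
        using that by (intro measurable_sets[OF meas V]) auto
    qed (use False in auto)
    ultimately show ?thesis by blast
  qed
  define T where "T = {s. length s = N \<and> P s}"
  have fin: "finite T" unfolding T_def by (rule finite_subset[OF _ finite_list_length[of N]]) auto
  have split: "?A P = (\<Union>s\<in>T. {\<omega> \<in> space M. sign_list \<epsilon> N \<omega> = s})"
    by (auto simp: T_def)
  show "?A P \<in> sets M" unfolding split using fin single by (intro sets.finite_UN) (auto simp: T_def)
  have "prob (?A P) = (\<Sum>s\<in>T. prob {\<omega> \<in> space M. sign_list \<epsilon> N \<omega> = s})"
    unfolding split using fin single
    by (intro finite_measure_finite_Union) (auto simp: T_def disjoint_family_on_def)
  also have "\<dots> = (\<Sum>s\<in>T. 1 / 2 ^ N)" using single by (intro sum.cong) (auto simp: T_def)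
  also have "\<dots> = (\<Sum>s | length s = N. of_bool (P s)) / 2 ^ N"
  proof -
    have "(\<Sum>s | length s = N. of_bool (P s) :: real) = (\<Sum>s\<in>T. 1)"
      unfolding T_def by (intro sum.mono_neutral_cong_right) (auto simp: finite_list_length)
    then show ?thesis by (simp add: sum_divide_distrib)
  qed
  finally show "prob (?A P) = sign_avg N (\<lambda>s. of_bool (P s))" by (simp add: sign_avg_def)
qed

section \<open>The blocks of a non-decreasing sequence\<close>

text \<open>
  The indices at which a non-decreasing sequence is below a given value form a downward closed set;
  this lemma turns such a set into an interval.
\<close>

lemma initial_segment_eq:
  fixes S :: "nat set"
  assumes "finite S" "\<And>i. i \<in> S \<Longrightarrow> i \<ge> 1" "\<And>i j. i \<in> S \<Longrightarrow> 1 \<le> j \<Longrightarrow> j \<le> i \<Longrightarrow> j \<in> S"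
  shows "S = {1..card S}"
proof (cases "S = {}")
  case False
  have "S \<subseteq> {1..Max S}" using assms(2) Max_ge[OF assms(1)] by auto
  moreover have "{1..Max S} \<subseteq> S" using assms(3)[OF Max_in[OF assms(1) False]] by auto
  ultimately have "S = {1..Max S}" by (rule antisym)
  then have "card S = Max S" by (metis card_atLeastAtMost diff_Suc_1 Suc_eq_plus1)
  then show ?thesis using \<open>S = {1..Max S}\<close> by simp
qed simp

definition count_below :: "(nat \<Rightarrow> nat) \<Rightarrow> nat \<Rightarrow> nat" where
  "count_below a n = card {i. i \<ge> 1 \<and> a i < n}"

lemma indices_below_eq:
  assumes "mono_on {1..} a" and unb: "\<And>n. \<exists>i\<ge>1. n \<le> a i"
  shows "{i. i \<ge> 1 \<and> a i < n} = {1..count_below a n}"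
proof -
  obtain i0 where i0: "i0 \<ge> 1" "n \<le> a i0" using unb by blast
  have "{i. i \<ge> 1 \<and> a i < n} \<subseteq> {..<i0}"
  proof
    fix i assume "i \<in> {i. i \<ge> 1 \<and> a i < n}"
    then show "i \<in> {..<i0}" using i0 mono_onD[OF assms(1), of i0 i] by (cases "i0 \<le> i") auto
  qed
  then have "finite {i. i \<ge> 1 \<and> a i < n}" by (rule finite_subset) auto
  then show ?thesis unfolding count_below_def
    using mono_onD[OF assms(1)] by (intro initial_segment_eq) (auto intro: le_less_trans)
qed

lemma sum_indices_below:
  fixes g :: "nat \<Rightarrow> real"
  assumes "mono_on {1..} a" and unb: "\<And>n. \<exists>i\<ge>1. n \<le> a i"
  shows "(\<Sum>i\<in>{1..count_below a n}. g (a i)) = (\<Sum>m<n. real (multiplicity_of a m) * g m)"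
proof -
  let ?S = "{1..count_below a n}"
  note S = indices_below_eq[OF assms, of n]
  have lt: "a i < n" if "i \<in> ?S" for i using that unfolding S[symmetric] by simp
  have "(\<Sum>i\<in>?S. g (a i)) = (\<Sum>m<n. \<Sum>i\<in>{i\<in>?S. a i = m}. g (a i))"
    by (rule sum.group[symmetric]) (use lt in auto)
  also have "\<dots> = (\<Sum>m<n. real (multiplicity_of a m) * g m)"
  proof (intro sum.cong refl)
    fix m assume "m \<in> {..<n}"
    then have "{i\<in>?S. a i = m} = {i. i \<ge> 1 \<and> a i = m}" unfolding S[symmetric] by auto
    then show "(\<Sum>i\<in>{i\<in>?S. a i = m}. g (a i)) = real (multiplicity_of a m) * g m"
      by (simp add: multiplicity_of_def)
  qed
  finally show ?thesis .
qed

lemma count_below_Suc: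
  assumes "mono_on {1..} a" and unb: "\<And>n. \<exists>i\<ge>1. n \<le> a i"
  shows "count_below a (Suc n) = count_below a n + multiplicity_of a n"
proof -
  have "real (count_below a m) = (\<Sum>k<m. real (multiplicity_of a k))" for m
    using sum_indices_below[OF assms, where g = "\<lambda>_. 1" and n = m] by simp
  from this[of n] this[of "Suc n"] show ?thesis by simp
qed

lemma card_coprime_below:
  assumes "mono_on {1..} a" and unb: "\<And>n. \<exists>i\<ge>1. n \<le> a i"
  shows "card {i\<in>{1..count_below a n}. coprime (a i) n} = (\<Sum>m | m < n \<and> coprime m n. multiplicity_of a m)"
proof -
  have "real (card {i\<in>{1..count_below a n}. coprime (a i) n}) = (\<Sum>i\<in>{1..count_below a n}. of_bool (coprime (a i) n))"
    by (simp add: Int_def)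
  also have "\<dots> = (\<Sum>m<n. real (multiplicity_of a m) * of_bool (coprime m n))"
    by (rule sum_indices_below[OF assms])
  also have "\<dots> = (\<Sum>m | m < n \<and> coprime m n. real (multiplicity_of a m))"
    by (intro sum.mono_neutral_cong_right) auto
  finally have "real (card {i\<in>{1..count_below a n}. coprime (a i) n})
      = real (\<Sum>m | m < n \<and> coprime m n. multiplicity_of a m)" by simp
  then show ?thesis by (simp only: of_nat_eq_iff)
qed

text \<open>
  A bounded sequence has only finitely many values of positive multiplicity, so its sums of
  multiplicities could not grow like \<open>n\<^sup>2\<close>.
\<close>

lemma steps_unbounded:
  assumes "eventually (\<lambda>n. (\<Sum>m | m < n \<and> coprime m n. multiplicity_of a m) \<ge> 2 * n\<^sup>2) sequentially"
  shows "\<exists>i\<ge>1. n \<le> a i"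
proof (rule ccontr)
  assume "\<not> (\<exists>i\<ge>1. n \<le> a i)"
  then have zero: "multiplicity_of a m = 0" if "m \<ge> n" for m
  proof -
    have "{i. i \<ge> 1 \<and> a i = m} = {}" using \<open>\<not> (\<exists>i\<ge>1. n \<le> a i)\<close> that by auto
    then show ?thesis by (simp only: multiplicity_of_def card.empty)
  qed
  then have lt: "m < n" if "multiplicity_of a m > 0" for m
    using that by (metis less_irrefl not_le)
  define B where "B = (\<Sum>m<n. multiplicity_of a m)"
  have "\<forall>\<^sub>F k in sequentially. 2 * k\<^sup>2 \<le> B"
    using assms
  proof eventually_elim
    case (elim k)
    have "(\<Sum>m | m < k \<and> coprime m k. multiplicity_of a m) = (\<Sum>m | m < n \<and> m < k \<and> coprime m k. multiplicity_of a m)"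
      using lt by (intro sum.mono_neutral_right) auto
    also have "\<dots> \<le> B" unfolding B_def by (intro sum_mono2) auto
    finally show ?case using elim by simp
  qed
  moreover have "\<forall>\<^sub>F k in sequentially. B < k" by (rule eventually_gt_at_top)
  ultimately have "\<forall>\<^sub>F k :: nat in sequentially. False"
  proof eventually_elim
    case (elim k)
    have "k \<le> k\<^sup>2" by (simp add: power2_eq_square)
    then show ?case using elim by linarith
  qed
  then show False by simp
qed

section \<open>Transience\<close>

text \<open>
  The radius \<open>R\<close> has to exceed both the fluctuation \<open>n * sqrt (2 * L n)\<close> of the walk within the block
  and the scale \<open>2 * n\<^sup>2\<close> at which the residue becomes equidistributed; this is the role of the maximum
  in the variance hypothesis, which says that \<open>R / \<sigma>\<close> is at most \<open>2 / ln n powr (3/2)\<close>.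
\<close>

lemma prob_visit_block_le:
  fixes M :: "'a measure" and a :: "nat \<Rightarrow> nat" and n :: nat and c :: int and \<delta> :: real
  defines "L \<equiv> multiplicity_of a"
  assumes rad: "rademacher_sequence M \<epsilon>"
    and mono: "mono_on {1..} a" and unb: "\<And>n. \<exists>i\<ge>1. n \<le> a i"
    and coprime: "(\<Sum>m | m < n \<and> coprime m n. L m) \<ge> 2 * n\<^sup>2"
    and variance: "(\<Sum>m=1..<n. real m ^ 2 * real (L m))
            \<ge> real n ^ 2 * ln (real n) powr (3 + \<delta>) * max (4 * real (L n)) (real n ^ 2)"
    and n: "n \<ge> 3" and \<delta>: "\<delta> > 0"
  shows "measure M {\<omega> \<in> space M. \<exists>k\<le>count_below a (Suc n). k \<ge> count_below a n
                \<and> signed_sum a 1 (sign_list \<epsilon> k \<omega>) = c}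
          \<le> 4032 * (1 / (real n * ln (real n) powr (3/2)))"
proof -
  define p N where "p = count_below a n" and "N = count_below a (Suc n)"
  note below = indices_below_eq[OF mono unb]
  define X where "X = max (4 * real (L n)) ((real n)\<^sup>2)"
  define R where "R = 2 * real n * sqrt X"
  define \<sigma> where "\<sigma> = sqrt (\<Sum>i\<in>{1..p}. (real (a i))\<^sup>2)"
  define l where "l = ln (real n) powr (3/2)"
  have "exp 1 \<le> real n" using exp_le n by linarith
  then have ln1: "1 \<le> ln (real n)" using n by (subst ln_ge_iff) auto
  then have l0: "l > 0" by (simp add: l_def)
  have X: "(real n)\<^sup>2 \<le> X" "4 * real (L n) \<le> X" by (simp_all add: X_def)
  have Xpos: "X > 0" using n X(1) by (intro less_le_trans[OF _ X(1)]) simp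
  have "real n \<le> sqrt X" using X(1) by (simp add: real_le_rsqrt)
  then have R: "2 * (real n)\<^sup>2 \<le> R" by (simp add: R_def power2_eq_square mult_left_mono)
  have R0: "R > 0" using n Xpos by (simp add: R_def)
  have Npn: "N = p + L n" unfolding N_def p_def L_def by (rule count_below_Suc[OF mono unb])

  have sum_sq: "(\<Sum>i\<in>{1..p}. (real (a i))\<^sup>2) = (\<Sum>m=1..<n. real m ^ 2 * real (L m))"
  proof -
    have "(\<Sum>i\<in>{1..p}. (real (a i))\<^sup>2) = (\<Sum>m<n. real (L m) * (real m)\<^sup>2)"
      unfolding p_def L_def by (rule sum_indices_below[OF mono unb, where g = "\<lambda>m. (real m)\<^sup>2"])
    also have "\<dots> = (\<Sum>m=1..<n. real (L m) * (real m)\<^sup>2)"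
    proof (rule sum.mono_neutral_right)
      show "\<forall>i\<in>{..<n} - {1..<n}. real (L i) * (real i)\<^sup>2 = 0"
        by (auto simp: not_le)
    qed auto
    finally show ?thesis by (simp add: mult.commute)
  qed
  have "l\<^sup>2 = ln (real n) powr 3"
    unfolding l_def power2_eq_square powr_add[symmetric] by simp
  then have "(real n * l * sqrt X)\<^sup>2 = (real n)\<^sup>2 * ln (real n) powr 3 * X"
    using Xpos by (simp add: power_mult_distrib)
  also have "\<dots> \<le> (real n)\<^sup>2 * ln (real n) powr (3 + \<delta>) * X"
    using ln1 \<delta> Xpos by (intro mult_right_mono mult_left_mono powr_mono) auto
  also have "\<dots> \<le> \<sigma>\<^sup>2"
    using variance unfolding \<sigma>_def sum_sq X_def by (subst real_sqrt_pow2) (auto intro: sum_nonneg)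
  finally have \<sigma>_ge: "real n * l * sqrt X \<le> \<sigma>"
    by (rule power2_le_imp_le) (simp add: \<sigma>_def sum_nonneg)
  moreover have "real n * l * sqrt X > 0" using n l0 Xpos by simp
  ultimately have \<sigma>0: "\<sigma> > 0" by linarith

  have set_eq: "{\<omega> \<in> space M. \<exists>k\<le>N. k \<ge> p \<and> signed_sum a 1 (sign_list \<epsilon> k \<omega>) = c}
      = {\<omega> \<in> space M. \<exists>k\<le>N. 1 + k > p \<and> 0 + signed_sum a 1 (take k (sign_list \<epsilon> N \<omega>)) = c}"
    by (intro Collect_cong conj_cong ex_cong1 refl) (auto simp: take_sign_list)
  have "measure M {\<omega> \<in> space M. \<exists>k\<le>N. k \<ge> p \<and> signed_sum a 1 (sign_list \<epsilon> k \<omega>) = c}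
      = sign_avg N (\<lambda>s. of_bool (\<exists>k\<le>N. 1 + k > p \<and> 0 + signed_sum a 1 (take k s) = c))"
    unfolding set_eq by (rule prob_sign_list(2)[OF rad])
  also have "\<dots> \<le> 2 * sign_avg N (\<lambda>s. of_bool (int n dvd 0 + signed_sum a 1 s - c
                          \<and> \<bar>of_int (0 + signed_sum a 1 s - c)\<bar> \<le> R))"
  proof (rule visit_le_twice_final_near)
    fix i assume i: "p < i" "i < 1 + N"
    then have "i \<in> {1..count_below a (Suc n)}" "i \<notin> {1..count_below a n}"
      by (simp_all add: p_def N_def)
    then have "i \<ge> 1 \<and> a i < Suc n" "\<not> (i \<ge> 1 \<and> a i < n)"
      unfolding below[symmetric] by blast+
    then show "a i = n" by linarith
  next
    have "2 * (real n)\<^sup>2 * real (L n) \<le> 4 * (real n)\<^sup>2 * X"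
    proof -
      have "real (L n) \<le> 2 * X" using X(2) by linarith
      then have "2 * (real n)\<^sup>2 * real (L n) \<le> 2 * (real n)\<^sup>2 * (2 * X)" by (intro mult_left_mono) auto
      then show ?thesis by simp
    qed
    then show "2 * (real n)\<^sup>2 * (real (1 + N) - 1 - real p) \<le> R\<^sup>2"
      using Xpos by (simp add: R_def Npn power_mult_distrib)
  qed (rule R0)
  also have "\<dots> \<le> 2 * (1008 * R / (real n * \<sigma>))"
  proof (intro mult_left_mono)
    have "sign_avg N (\<lambda>s. of_bool (int n dvd signed_sum a 1 s - c \<and> \<bar>of_int (signed_sum a 1 s - c)\<bar> \<le> R))
          \<le> 1008 * R / (real n * \<sigma>)"
    proof (rule anticoncentration_mod[where I = "{1..p}"])
      show "{1..p} \<subseteq> {1..<1 + N}" by (auto simp: Npn)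
      show "a i < n" if "i \<in> {1..p}" for i
        using that unfolding p_def below[symmetric] by auto
      show "2 * n\<^sup>2 \<le> card {i \<in> {1..p}. coprime (a i) n}"
        unfolding p_def card_coprime_below[OF mono unb] using coprime by (simp add: L_def)
      show "\<sigma>\<^sup>2 = (\<Sum>i\<in>{1..p}. (real (a i))\<^sup>2)" by (simp add: \<sigma>_def sum_nonneg)
    qed (use n \<sigma>0 R in auto)
    then show "sign_avg N (\<lambda>s. of_bool (int n dvd 0 + signed_sum a 1 s - c
                          \<and> \<bar>of_int (0 + signed_sum a 1 s - c)\<bar> \<le> R)) \<le> 1008 * R / (real n * \<sigma>)"
      by simp
  qed simp
  also have "\<dots> \<le> 2 * (1008 * R / (real n * (real n * l * sqrt X)))"
  proof (rule mult_left_mono, rule divide_left_mono)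
    show "real n * (real n * l * sqrt X) \<le> real n * \<sigma>"
      by (rule mult_left_mono[OF \<sigma>_ge]) simp
    show "0 < (real n * \<sigma>) * (real n * (real n * l * sqrt X))"
      using n l0 Xpos \<sigma>0 by (intro mult_pos_pos) simp_all
  qed (use R0 in simp_all)
  also have "\<dots> = 4032 * (1 / (real n * l))"
  proof -
    have "real n \<noteq> 0" "sqrt X \<noteq> 0" "l \<noteq> 0" using n Xpos l0 by auto
    then show ?thesis unfolding R_def by (simp add: divide_simps)
  qed
  finally show ?thesis by (simp add: p_def N_def l_def)
qed

lemma measure_eq_0_if_AE_not:
  assumes "AE \<omega> in M. \<not> P \<omega>"
  shows "measure M {\<omega> \<in> space M. P \<omega>} = 0"
proof (cases "{\<omega> \<in> space M. P \<omega>} \<in> sets M")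
  case True
  then have "emeasure M {\<omega> \<in> space M. P \<omega>} = 0"
    using assms AE_iff_measurable[OF True, of "\<lambda>\<omega>. \<not> P \<omega>"] by simp
  then show ?thesis by (simp add: measure_def)
qed (simp add: measure_notin_sets)

theorem theorem5:
  fixes M :: "'a measure"
    and \<epsilon> :: "nat \<Rightarrow> 'a \<Rightarrow> real"
    and a :: "nat \<Rightarrow> nat"
    and L :: "nat \<Rightarrow> nat"
    and \<delta> :: real
  assumes "rademacher_sequence M \<epsilon>"
    and "mono_on {1..} a"
    and "\<And>n. L n = multiplicity_of a n"
    and "\<delta> > 0"
    and "eventually (\<lambda>n. (\<Sum>m | m < n \<and> coprime m n. L m) \<ge> 2 * n\<^sup>2) sequentially"
    and "eventually (\<lambda>n. (\<Sum>m=1..<n. real m ^ 2 * real (L m))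
            \<ge> real n ^ 2 * ln (real n) powr (3 + \<delta>) * max (4 * real (L n)) (real n ^ 2)) sequentially"
  shows "transient M (rademacher_walk \<epsilon> (\<lambda>i. real (a i)))"
proof -
  interpret prob_space M using assms(1) by (simp add: rademacher_sequence_def)
  have unb: "\<exists>i\<ge>1. n \<le> a i" for n
    using assms(5) unfolding assms(3) by (rule steps_unbounded)
  note below = indices_below_eq[OF assms(2) unb]
  let ?p = "count_below a"
  let ?Z = "\<lambda>k \<omega>. signed_sum a 1 (sign_list \<epsilon> k \<omega>)"
  define A where "A c n = {\<omega> \<in> space M. \<exists>k\<le>?p (Suc n). k \<ge> ?p n \<and> ?Z k \<omega> = c}" for c n
  have A_sets: "A c n \<in> sets M" for c n
  proof -
    have "A c n = {\<omega> \<in> space M. \<exists>k\<le>?p (Suc n). k \<ge> ?p n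
        \<and> signed_sum a 1 (take k (sign_list \<epsilon> (?p (Suc n)) \<omega>)) = c}"
      unfolding A_def by (auto simp: take_sign_list)
    then show ?thesis using prob_sign_list(1)[OF assms(1)] by simp
  qed
  have "AE \<omega> in M. eventually (\<lambda>n. \<omega> \<in> space M - A c n) sequentially" for c
  proof (rule borel_cantelli_AE1)
    have "\<forall>\<^sub>F n in sequentially. norm (prob (A c n)) \<le> 4032 * (1 / (real n * ln (real n) powr (3/2)))"
      using assms(5,6) eventually_ge_at_top[of 3]
    proof eventually_elim
      case (elim n)
      then show ?case
        using prob_visit_block_le[OF assms(1,2) unb _ _ _ assms(4), of n c]
        by (simp add: A_def assms(3))
    qed
    then show "summable (\<lambda>n. measure M (A c n))"
      by (rule summable_comparison_test_ev) (intro summable_mult summable_bertrand)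
  qed (auto simp: A_sets emeasure_eq_measure)
  then have "AE \<omega> in M. \<forall>c. eventually (\<lambda>n. \<omega> \<in> space M - A c n) sequentially"
    by (simp add: AE_all_countable)
  with rademacher_AE_sign[OF assms(1)]
  have "AE \<omega> in M. \<not> (\<exists>C::real. \<exists>\<^sub>\<infinity>n. \<bar>rademacher_walk \<epsilon> (\<lambda>i. real (a i)) n \<omega>\<bar> \<le> C)"
  proof eventually_elim
    case (elim \<omega>)
    have Z: "rademacher_walk \<epsilon> (\<lambda>i. real (a i)) n \<omega> = of_int (?Z n \<omega>)" for n
      using elim(1) by (intro rademacher_walk_eq_signed_sum) auto
    show ?case
    proof
      assume "\<exists>C::real. \<exists>\<^sub>\<infinity>n. \<bar>rademacher_walk \<epsilon> (\<lambda>i. real (a i)) n \<omega>\<bar> \<le> C"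
      then obtain C :: real where inf: "infinite {k. \<bar>of_int (?Z k \<omega>)\<bar> \<le> C}"
        unfolding Z by (auto simp: INFM_iff_infinite)
      \<comment> \<open>Infinitely many visits to a bounded set of integers mean infinitely many visits to one integer.\<close>
      have "(\<lambda>k. ?Z k \<omega>) ` {k. \<bar>of_int (?Z k \<omega>)\<bar> \<le> C} \<subseteq> {- \<lfloor>C\<rfloor>..\<lfloor>C\<rfloor>}"
      proof clarify
        fix k assume "\<bar>of_int (?Z k \<omega>)\<bar> \<le> C"
        then have "?Z k \<omega> \<le> \<lfloor>C\<rfloor>" "- ?Z k \<omega> \<le> \<lfloor>C\<rfloor>"
          by (simp_all only: le_floor_iff of_int_minus abs_le_iff)
        then show "?Z k \<omega> \<in> {- \<lfloor>C\<rfloor>..\<lfloor>C\<rfloor>}" by auto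
      qed
      then have "finite ((\<lambda>k. ?Z k \<omega>) ` {k. \<bar>of_int (?Z k \<omega>)\<bar> \<le> C})"
        by (rule finite_subset) auto
      from pigeonhole_infinite[OF inf this] obtain k0
        where k0: "infinite {k. \<bar>of_int (?Z k \<omega>)\<bar> \<le> C \<and> ?Z k \<omega> = ?Z k0 \<omega>}" by auto
      define c where "c = ?Z k0 \<omega>"
      have infc: "infinite {k. ?Z k \<omega> = c}"
        using k0 by (rule contrapos_nn) (auto simp: c_def elim: finite_subset[rotated])
      obtain n0 where n0: "\<And>n. n \<ge> n0 \<Longrightarrow> \<omega> \<in> space M - A c n"
        using elim(2) unfolding eventually_sequentially by blast
      obtain k where k: "k > ?p n0" "?Z k \<omega> = c"
        using infc unfolding infinite_nat_iff_unbounded by blast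
      then have "k \<ge> 1" "k \<notin> {1..?p n0}" by auto
      then have "n0 \<le> a k" unfolding below[symmetric] by auto
      moreover have "\<omega> \<in> A c (a k)"
      proof -
        have "k \<in> {i. i \<ge> 1 \<and> a i < Suc (a k)}" "k \<notin> {i. i \<ge> 1 \<and> a i < a k}" using \<open>k \<ge> 1\<close> by auto
        then have "k \<le> ?p (Suc (a k))" "?p (a k) \<le> k" unfolding below using \<open>k \<ge> 1\<close> by auto
        moreover have "\<omega> \<in> space M" using n0[of n0] by auto
        ultimately show ?thesis using k(2) by (auto simp: A_def)
      qed
      ultimately show False using n0 by blast
    qed
  qed
  then have "measure M {\<omega> \<in> space M. \<exists>C::real. \<exists>\<^sub>\<infinity>n. \<bar>rademacher_walk \<epsilon> (\<lambda>i. real (a i)) n \<omega>\<bar> \<le> C} = 0"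
    by (rule measure_eq_0_if_AE_not)
  then show ?thesis by (simp add: transient_def weakly_recurrent_def)
qed

end
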